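(* Let $a,b$ be real numbers with $a<1$, $ab>1$ and $b$ an integer greater than $2$. Suppose that the product $ab$ is a root of a Littlewood polynomial of degree $k-1$, namely $$\sum_{n=0}^{k-1}\epsilon_n (ab)^n=0$$ for some sequence $(\epsilon_n)_{n\in\{0,\dots,k-1\}}$ with values in $\{-1,1\}$. Then $$\dim_{\mathrm{A}}\Gamma_{T_{a,b}}\ \geq\ 1+\frac1k .$$
   Context: Let $T:\mathbb{R}\to\mathbb{R}$ be the tent map: the function of period $1$ with $T(x)=x$ for $x\in[0,\frac12]$ and $T(x)=1-x$ for $x\in[\frac12,1]$. The Takagi function is $T_{a,b}(x)=\sum_{n=0}^{\infty}a^nT(b^nx)$. For $f:\mathbb{R}\to\mathbb{R}$, the graph of $f$ over $[0,1]$ is $\Gamma_f=\{(x,y)\in\mathbb{R}^2: x\in[0,1],\ y=f(x)\}$. For a bounded set $F\subset\mathbb{R}^n$, $N_r(F)$ is the minimal number of balls of size $r>0$ needed to cover $F$. The Assouad dimension of $F$ is $$\dim_{\mathrm{A}}F=\inf\Big\{s\ge 0:\ \exists C>0\ \forall R>0\ \forall r\in(0,R)\ \forall x\in F:\ N_r(B(x,R)\cap F)\le C\Big(\frac Rr\Big)^s\Big\},$$ where $B(x,R)$ is the closed ball of centre $x$ and radius $R$. *)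

theory Defs
  imports "HOL-Analysis.Analysis"
begin

definition tent :: "real \<Rightarrow> real" where
  "tent x = (if frac x \<le> 1/2 then frac x else 1 - frac x)"

lemma tent_periodic: "tent (x + 1) = tent x"
  by (simp add: tent_def frac_1_eq)

lemma tent_left: "x \<in> {0..1/2} \<Longrightarrow> tent x = x"
  by (simp add: tent_def frac_eq)

lemma tent_right: "x \<in> {1/2..1} \<Longrightarrow> tent x = 1 - x"
  by (cases "x = 1") (auto simp: tent_def frac_eq)

text \<open>The series converges for \<open>\<bar>a\<bar> < 1\<close>; otherwise the value of \<open>takagi a b x\<close> may be
  meaningless.\<close>

definition takagi :: "real \<Rightarrow> real \<Rightarrow> real \<Rightarrow> real" where
  "takagi a b x = (\<Sum>n. a ^ n * tent (b ^ n * x))"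

lemma summable_takagi:
  assumes "\<bar>a\<bar> < 1"
  shows "summable (\<lambda>n. a ^ n * tent (b ^ n * x))"
proof (rule summable_comparison_test')
  show "summable (\<lambda>n. \<bar>a\<bar> ^ n)"
    using assms by simp
  have "\<bar>tent y\<bar> \<le> 1" for y
    using frac_ge_0[of y] less_imp_le[OF frac_lt_1[of y]] unfolding tent_def abs_le_iff
    by (cases "frac y \<le> 1/2") (simp_all only: if_True if_False simp_thms, linarith+)
  then show "norm (a ^ n * tent (b ^ n * x)) \<le> \<bar>a\<bar> ^ n" if "n \<ge> 0" for n
    using mult_left_le[of "\<bar>tent (b ^ n * x)\<bar>" "\<bar>a\<bar> ^ n"] by (simp add: abs_mult power_abs)
qed

text \<open>The type \<open>real \<times> real\<close> carries the Euclidean metric.\<close>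

definition graph_on_unit :: "(real \<Rightarrow> real) \<Rightarrow> (real \<times> real) set" where
  "graph_on_unit f = {(x, y). x \<in> {0..1} \<and> y = f x}"

text \<open>Balls of size \<open>r\<close> are closed balls of radius \<open>r\<close>, whose centres need not lie in the
  covered set. The definition is meant for bounded sets, for which a finite cover exists.\<close>

definition covering_number :: "real \<Rightarrow> 'a::euclidean_space set \<Rightarrow> nat" where
  "covering_number r F = (LEAST m. \<exists>S. finite S \<and> card S = m \<and> F \<subseteq> (\<Union>c\<in>S. cball c r))"

lemma finite_cover_exists:
  fixes F :: "'a::euclidean_space set"
  assumes "bounded F" and "r > 0"
  shows "\<exists>S. finite S \<and> F \<subseteq> (\<Union>c\<in>S. cball c r)"
proof -
  have "compact (closure F)"
    using assms(1) by simp
  then obtain S where S: "finite S" "closure F \<subseteq> (\<Union>c\<in>S. ball c r)"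
    using assms(2) unfolding compact_eq_totally_bounded by blast
  have "F \<subseteq> (\<Union>c\<in>S. cball c r)"
  proof
    fix x assume "x \<in> F"
    then have "x \<in> closure F"
      using closure_subset by blast
    with S(2) obtain c where "c \<in> S" "x \<in> ball c r"
      by blast
    then show "x \<in> (\<Union>c\<in>S. cball c r)"
      by (auto intro: less_imp_le)
  qed
  with S(1) show ?thesis
    by blast
qed

text \<open>The infimum is taken in the extended reals, so that no junk value arises from an empty set of
  exponents.\<close>

definition assouad_dim :: "'a::euclidean_space set \<Rightarrow> ereal" where
  "assouad_dim F = Inf (ereal ` {s. s \<ge> 0 \<and>
     (\<exists>C>0. \<forall>R>0. \<forall>r\<in>{0<..<R}. \<forall>x\<in>F.
        real (covering_number r (cball x R \<inter> F)) \<le> C * (R / r) powr s)})"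

end

(* The signs of the slopes of T(b^n x), n < k, can be prescribed on a suitable interval J of length
   b^(1-k)/2 (up to a global sign). For the signs of the Littlewood polynomial, the first k terms of
   the series add up to a constant on J, because their total slope is the value of the polynomial at
   ab. Hence J splits into b half-periods of T(b^k x), and on each of them the Takagi function f is a
   copy c + a^k f of f on [0, 1/2], scaled by b^(-k), with the same c for all b copies. Iterating, an
   interval of length R = b^(-kp)/2 contains b^q copies of width r = b^(-k(p+q))/2, all at the same
   height. Since ab > 1, for large p each of these copies is taller than R, so about
   b^q (R/r) = (R/r)^(1+1/k) balls of radius r are needed to cover the graph in a ball of radius R. *)

theory Submission
  imports Defs
begin

section \<open>The tent map: symmetries, affine pieces, continuity\<close>

lemma tent_minus: "tent (- x) = tent x"
  by (cases "x \<in> \<int>") (auto simp: tent_def frac_neg elim!: Ints_cases)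

lemma tent_add_of_int: "tent (x + of_int n) = tent x"
  by (simp add: tent_def frac_def)

lemma tent_nonneg: "0 \<le> tent x"
  using frac_lt_1[of x] by (auto simp: tent_def)

lemma tent_le_half: "tent x \<le> 1/2"
  by (auto simp: tent_def)

text \<open>Shifting by a period leaves the cases \<open>N = 0\<close> and \<open>N = 1\<close>. The
  parity of \<open>N\<close> fixes the sign of the slope; signs are later prescribed by choosing
  this parity.\<close>

lemma tent_half_interval:
  fixes N :: int
  assumes "of_int N / 2 \<le> y" "y \<le> of_int (N + 1) / 2"
  shows "tent y = (if even N then y - of_int N / 2 else of_int (N + 1) / 2 - y)"
proof (cases "even N")
  case True
  then obtain M where "N = 2 * M" by blast
  then show ?thesis
    using assms tent_add_of_int[of "y - of_int M" M] tent_left[of "y - of_int M"]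
    by (simp add: field_simps)
next
  case False
  then obtain M where "N = 2 * M + 1" by (rule oddE)
  then show ?thesis
    using assms tent_add_of_int[of "y - of_int M" M] tent_right[of "y - of_int M"]
    by (simp add: field_simps)
qed

text \<open>\<open>arccos\<close> inverts \<open>cos\<close> on [0, pi], and \<open>cos\<close> has
  the same reflection and period as the tent. The closed form yields continuity without gluing
  affine pieces.\<close>

lemma tent_eq_arccos: "tent x = arccos (cos (2 * pi * x)) / (2 * pi)"
proof -
  have "2 * pi * x = 2 * pi * frac x + 2 * pi * of_int \<lfloor>x\<rfloor>"
    by (simp add: frac_def algebra_simps)
  then have cos_frac: "cos (2 * pi * x) = cos (2 * pi * frac x)"
    by (simp add: cos_add)
  show ?thesis
  proof (cases "frac x \<le> 1/2")
    case True
    then have "arccos (cos (2 * pi * frac x)) = 2 * pi * frac x"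
      by (intro arccos_cos) auto
    with True cos_frac show ?thesis
      by (simp add: tent_def)
  next
    case False
    have "cos (2 * pi * frac x) = cos (2 * pi - 2 * pi * frac x)"
      by (simp add: cos_diff)
    also have "\<dots> = cos (2 * pi * (1 - frac x))"
      by (simp add: algebra_simps)
    also have "arccos \<dots> = 2 * pi * (1 - frac x)"
      using False frac_lt_1[of x] by (intro arccos_cos) auto
    finally show ?thesis
      using False cos_frac by (simp add: tent_def)
  qed
qed

lemma continuous_on_tent: "continuous_on S tent"
proof -
  have "continuous_on S (\<lambda>x. arccos (cos (2 * pi * x)) / (2 * pi))"
    by (intro continuous_intros) auto
  then show ?thesis
    by (simp add: tent_eq_arccos[abs_def])
qed

section \<open>The Takagi function: symmetries, functional equation, range\<close>

lemma takagi_minus: "takagi a b (- x) = takagi a b x"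
  by (simp add: takagi_def tent_minus)

text \<open>As \<open>b\<close> is an integer, every term sees the shift by \<open>n\<close> as the
  integer shift \<open>b ^ m * n\<close>.\<close>

lemma takagi_add_of_int: "takagi a (of_int b) (x + of_int n) = takagi a (of_int b) x"
proof -
  have "tent (of_int b ^ m * (x + of_int n)) = tent (of_int b ^ m * x)" for m
    using tent_add_of_int[of "of_int b ^ m * x" "b ^ m * n"] by (simp add: algebra_simps)
  then show ?thesis
    by (simp add: takagi_def)
qed

text \<open>Wherever the first \<open>k\<close> terms add up to a constant, this makes the function
  an affine image of itself.\<close>

lemma takagi_split:
  assumes "\<bar>a\<bar> < 1"
  shows "takagi a b x = (\<Sum>m<k. a ^ m * tent (b ^ m * x)) + a ^ k * takagi a b (b ^ k * x)"
proof -
  have "takagi a b x = (\<Sum>m. a ^ (m + k) * tent (b ^ (m + k) * x))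
      + (\<Sum>m<k. a ^ m * tent (b ^ m * x))"
    unfolding takagi_def by (rule suminf_split_initial_segment[OF summable_takagi[OF assms]])
  also have "(\<Sum>m. a ^ (m + k) * tent (b ^ (m + k) * x))
      = (\<Sum>m. a ^ k * (a ^ m * tent (b ^ m * (b ^ k * x))))"
    by (simp add: power_add mult_ac)
  also have "\<dots> = a ^ k * takagi a b (b ^ k * x)"
    unfolding takagi_def by (rule suminf_mult[OF summable_takagi[OF assms]])
  finally show ?thesis
    by simp
qed

lemma continuous_on_takagi:
  assumes "\<bar>a\<bar> < 1"
  shows "continuous_on S (takagi a b)"
proof -
  have "uniform_limit S (\<lambda>n x. \<Sum>i<n. a ^ i * tent (b ^ i * x))
      (\<lambda>x. \<Sum>i. a ^ i * tent (b ^ i * x)) sequentially"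
  proof (rule Weierstrass_m_test)
    show "norm (a ^ n * tent (b ^ n * x)) \<le> \<bar>a\<bar> ^ n" for n x
      using mult_left_le[of "\<bar>tent (b ^ n * x)\<bar>" "\<bar>a\<bar> ^ n"]
        tent_nonneg[of "b ^ n * x"] tent_le_half[of "b ^ n * x"]
      by (simp add: abs_mult power_abs)
    show "summable (\<lambda>n. \<bar>a\<bar> ^ n)"
      using assms by simp
  qed
  then have "continuous_on S (\<lambda>x. \<Sum>i. a ^ i * tent (b ^ i * x))"
    by (rule uniform_limit_theorem[rotated])
      (auto intro!: always_eventually continuous_intros
        continuous_on_compose2[OF continuous_on_tent[of UNIV]])
  then show ?thesis
    by (simp add: takagi_def[abs_def])
qed

lemma takagi_0: "takagi a b 0 = 0"
  by (simp add: takagi_def tent_def)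

lemma takagi_half_ge:
  assumes "0 \<le> a" "a < 1"
  shows "takagi a b (1/2) \<ge> 1/2"
proof -
  have "takagi a b (1/2) \<ge> (\<Sum>n<1. a ^ n * tent (b ^ n * (1/2)))"
    unfolding takagi_def using assms
    by (intro sum_le_suminf summable_takagi) (auto simp: tent_nonneg)
  then show ?thesis
    using tent_left[of "1/2"] by simp
qed

text \<open>Intermediate value theorem between the value 0 at 0 and a value of at least 1/2 at 1/2.
  This is the source of the height of the self-affine copies.\<close>

lemma takagi_onto_half:
  assumes "0 \<le> a" "a < 1" "v \<in> {0..1/2}"
  shows "\<exists>t\<in>{0..1/2}. takagi a b t = v"
  using IVT'[of "takagi a b" 0 v "1/2"] assms takagi_0[of a b] takagi_half_ge[of a b]
    continuous_on_takagi[of a "{0..1/2}" b]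
  by auto

section \<open>Prescribing the slopes of the first terms\<close>

text \<open>The intervals [N, N + 1] / (2 b^m) are nested: each splits into \<open>b\<close>
  half-periods of the next term, whose slopes alternate in sign, so any next sign can be realized.
  The start is [0, 1/2], where the slope is 1, hence \<open>\<epsilon> 0 = 1\<close>. The bound on
  \<open>N + 1\<close> keeps the interval inside [0, 1/2].\<close>

lemma linear_on_half_interval:
  fixes b :: int and \<epsilon> :: "nat \<Rightarrow> real"
  assumes "b \<ge> 2" and \<epsilon>: "\<And>n. n \<le> m \<Longrightarrow> \<epsilon> n \<in> {-1, 1}" and "\<epsilon> 0 = 1"
  shows "\<exists>(N::int)\<ge>0. N + 1 \<le> b ^ m \<and>
    (\<forall>j\<le>m. \<exists>u. \<forall>x. of_int N \<le> 2 * of_int b ^ m * x \<and> 2 * of_int b ^ m * x \<le> of_int N + 1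
      \<longrightarrow> tent (of_int b ^ j * x) = u + \<epsilon> j * (of_int b ^ j * x))"
  using \<epsilon>
proof (induction m)
  case 0
  show ?case
    using \<open>\<epsilon> 0 = 1\<close> by (intro exI[of _ 0]) (auto simp: tent_left intro!: exI[of _ 0])
next
  case (Suc m)
  then obtain N :: int where N: "N \<ge> 0" "N + 1 \<le> b ^ m"
    and lin: "\<And>j. j \<le> m \<Longrightarrow> \<exists>u. \<forall>x. of_int N \<le> 2 * of_int b ^ m * x
      \<and> 2 * of_int b ^ m * x \<le> of_int N + 1 \<longrightarrow> tent (of_int b ^ j * x) = u + \<epsilon> j * (of_int b ^ j * x)"
    by force
  \<comment> \<open>The first two of the \<open>b\<close> subintervals have numbers of opposite
    parity, so one of them has the required slope.\<close>
  have "\<exists>d\<in>{0, 1}. even (b * N + d) = (\<epsilon> (Suc m) = 1)"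
    by (cases "even (b * N)"; cases "\<epsilon> (Suc m) = 1") auto
  then obtain d where d: "d \<in> {0, 1}" "even (b * N + d) = (\<epsilon> (Suc m) = 1)"
    by blast
  define M where "M = b * N + d"
  have M: "0 \<le> M" "b * N \<le> M" "M + 1 \<le> b * (N + 1)"
    using d \<open>b \<ge> 2\<close> N by (auto simp: M_def algebra_simps)
  have M': "of_int b * of_int N \<le> (of_int M :: real)" "of_int M + 1 \<le> (of_int b * (of_int N + 1) :: real)"
    using M(2,3) unfolding of_int_mult[symmetric] of_int_add[symmetric] of_int_1[symmetric, where 'a=real] of_int_le_iff
    by simp_all
  show ?case
  proof (intro exI[of _ M] conjI allI impI)
    show "0 \<le> M" by (fact M(1))
    have "b * (N + 1) \<le> b * b ^ m"
      using N \<open>b \<ge> 2\<close> by (intro mult_left_mono) auto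
    with M show "M + 1 \<le> b ^ Suc m"
      by simp
    fix j assume j: "j \<le> Suc m"
    show "\<exists>u. \<forall>x. of_int M \<le> 2 * of_int b ^ Suc m * x \<and> 2 * of_int b ^ Suc m * x \<le> of_int M + 1
      \<longrightarrow> tent (of_int b ^ j * x) = u + \<epsilon> j * (of_int b ^ j * x)"
    proof (cases "j = Suc m")
      case True
      define u where "u = (if even M then - of_int M / 2 else of_int (M + 1) / 2 :: real)"
      have "\<epsilon> (Suc m) = (if even M then 1 else - 1)"
        using Suc.prems[of "Suc m"] d(2) by (auto simp: M_def)
      then have "tent y = u + \<epsilon> j * y" if "of_int M \<le> 2 * y" "2 * y \<le> of_int M + 1" for y
        using tent_half_interval[of M y] that True by (auto simp: u_def)
      then show ?thesis
        using True by (intro exI[of _ u]) (auto simp: mult.assoc)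
    next
      case False
      then obtain u where u: "\<And>x. of_int N \<le> 2 * of_int b ^ m * x
        \<and> 2 * of_int b ^ m * x \<le> of_int N + 1 \<longrightarrow> tent (of_int b ^ j * x) = u + \<epsilon> j * (of_int b ^ j * x)"
        using lin[of j] j by (auto simp: le_Suc_eq)
      \<comment> \<open>The new interval lies inside the old one, so the formulas for the earlier
        terms remain valid there.\<close>
      have "of_int N \<le> 2 * of_int b ^ m * x \<and> 2 * of_int b ^ m * x \<le> of_int N + 1"
        if "of_int M \<le> 2 * of_int b ^ Suc m * x" "2 * of_int b ^ Suc m * x \<le> of_int M + 1" for x :: real
      proof -
        have "of_int b * of_int N \<le> of_int b * (2 * of_int b ^ m * x)"
          "of_int b * (2 * of_int b ^ m * x) \<le> of_int b * (of_int N + 1)"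
          using that M' by (simp_all add: mult_ac)
        then show ?thesis
          using \<open>b \<ge> 2\<close> by (simp add: mult_le_cancel_left_pos)
      qed
      with u show ?thesis by blast
    qed
  qed
qed

section \<open>Self-affine copies at a common height\<close>

text \<open>Isometry of [0, 1/2] onto the half-period [i/2, (i + 1)/2], reflecting when
  \<open>i\<close> is odd. Functions that are even and have period 1 are thus preserved.\<close>

definition unfold_half :: "int \<Rightarrow> real \<Rightarrow> real" where
  "unfold_half i t = (if even i then of_int i / 2 + t else of_int (i + 1) / 2 - t)"

lemma unfold_half_diff: "\<bar>unfold_half i t - unfold_half i t'\<bar> = \<bar>t - t'\<bar>"
  by (simp add: unfold_half_def abs_minus_commute)

lemma unfold_half_bounds:
  assumes "\<delta> \<le> t" "t \<le> 1/2 - \<delta>"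
  shows "of_int i / 2 + \<delta> \<le> unfold_half i t" "unfold_half i t \<le> of_int (i + 1) / 2 - \<delta>"
  using assms by (auto simp: unfold_half_def field_simps)

text \<open>The margin \<open>\<delta>\<close> stands for the half-width of an interval centred at
  \<open>t\<close> or \<open>t'\<close> inside [0, 1/2]. Images in different half-periods do not
  overlap, so their centres are two half-widths apart.\<close>

lemma unfold_half_separated:
  assumes "i < j" "t \<in> {\<delta>..1/2 - \<delta>}" "t' \<in> {\<delta>..1/2 - \<delta>}"
  shows "2 * \<delta> \<le> unfold_half j t' - unfold_half i t"
proof -
  have "of_int (i + 1) \<le> (of_int j :: real)"
    using assms(1) unfolding of_int_le_iff by simp
  moreover have "unfold_half i t \<le> of_int (i + 1) / 2 - \<delta>" "of_int j / 2 + \<delta> \<le> unfold_half j t'"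
    using unfold_half_bounds(2)[of \<delta> t i] unfold_half_bounds(1)[of \<delta> t' j] assms(2,3) by simp_all
  ultimately show ?thesis
    by argo
qed

lemma takagi_unfold_half: "takagi a (of_int b) (unfold_half i t) = takagi a (of_int b) t"
proof (cases "even i")
  case True
  then obtain j where "i = 2 * j" by blast
  then show ?thesis
    using takagi_add_of_int[of a b t j] by (simp add: unfold_half_def add.commute)
next
  case False
  then obtain j where "i = 2 * j + 1" by (rule oddE)
  then have "unfold_half i t = - t + of_int (j + 1)"
    by (simp add: unfold_half_def field_simps)
  then show ?thesis
    using takagi_add_of_int[of a b "- t" "j + 1"] by (simp add: takagi_minus)
qed

text \<open>The maps \<open>h i\<close> are the inverse branches of multiplication by b^k onto the
  \<open>b\<close> half-periods where the first \<open>k\<close> terms sum to a constant. That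
  constant is \<open>c\<close>, which therefore does not depend on \<open>i\<close>. The other
  clauses are what iteration requires: contraction, invariance of [0, 1/2] with margins, and
  separation of different branches.\<close>

lemma takagi_self_affine_pieces:
  fixes b :: int and \<epsilon> :: "nat \<Rightarrow> real"
  assumes "0 \<le> a" "a < 1" "b \<ge> 2" "k \<ge> 1"
    and \<epsilon>: "\<And>n. n < k \<Longrightarrow> \<epsilon> n \<in> {-1, 1}"
    and root: "(\<Sum>n<k. \<epsilon> n * (a * of_int b) ^ n) = 0"
  obtains h :: "int \<Rightarrow> real \<Rightarrow> real" and c :: real where
    "\<And>i t. i \<in> {0..<b} \<Longrightarrow> t \<in> {0..1/2} \<Longrightarrow>
      takagi a (of_int b) (h i t) = c + a ^ k * takagi a (of_int b) t"
    "\<And>i t t'. \<bar>h i t - h i t'\<bar> = \<bar>t - t'\<bar> / of_int b ^ k"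
    "\<And>i t \<delta>. i \<in> {0..<b} \<Longrightarrow> 0 \<le> \<delta> \<Longrightarrow> t \<in> {\<delta>..1/2 - \<delta>} \<Longrightarrow>
      h i t \<in> {\<delta> / of_int b ^ k..1/2 - \<delta> / of_int b ^ k}"
    "\<And>i j t t' \<delta>. i \<noteq> j \<Longrightarrow> t \<in> {\<delta>..1/2 - \<delta>} \<Longrightarrow> t' \<in> {\<delta>..1/2 - \<delta>} \<Longrightarrow>
      2 * \<delta> / of_int b ^ k \<le> \<bar>h i t - h j t'\<bar>"
proof -
  let ?b = "of_int b :: real"
  let ?f = "takagi a ?b"
  \<comment> \<open>Multiplying by the sign \<open>\<epsilon> 0\<close> keeps the root and makes the
    leading sign 1, the slope of the tent on [0, 1/2].\<close>
  define \<eta> where "\<eta> n = \<epsilon> 0 * \<epsilon> n" for n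
  have \<eta>: "\<eta> n \<in> {-1, 1}" if "n < k" for n
    using \<epsilon>[OF that] \<epsilon>[of 0] \<open>k \<ge> 1\<close> by (auto simp: \<eta>_def)
  have "\<eta> 0 = 1"
    using \<epsilon>[of 0] \<open>k \<ge> 1\<close> by (auto simp: \<eta>_def)
  have "(\<Sum>n<k. \<eta> n * (a * ?b) ^ n) = \<epsilon> 0 * (\<Sum>n<k. \<epsilon> n * (a * ?b) ^ n)"
    unfolding sum_distrib_left by (simp add: \<eta>_def mult_ac)
  then have root': "(\<Sum>n<k. \<eta> n * (a * ?b) ^ n) = 0"
    using root by simp
  obtain m where m: "k = Suc m"
    using \<open>k \<ge> 1\<close> by (cases k) auto
  then have "\<And>n. n \<le> m \<Longrightarrow> \<eta> n \<in> {-1, 1}"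
    using \<eta> by simp
  from linear_on_half_interval[of b m \<eta>, OF \<open>b \<ge> 2\<close> this \<open>\<eta> 0 = 1\<close>]
  obtain N :: int where N: "0 \<le> N" "N + 1 \<le> b ^ m"
    and lin: "\<And>j. j \<le> m \<Longrightarrow> \<exists>u. \<forall>x. of_int N \<le> 2 * ?b ^ m * x \<and> 2 * ?b ^ m * x \<le> of_int N + 1
      \<longrightarrow> tent (?b ^ j * x) = u + \<eta> j * (?b ^ j * x)"
    by blast
  obtain u where u: "\<And>j x. j \<le> m \<Longrightarrow> of_int N \<le> 2 * ?b ^ m * x \<Longrightarrow>
      2 * ?b ^ m * x \<le> of_int N + 1 \<Longrightarrow> tent (?b ^ j * x) = u j + \<eta> j * (?b ^ j * x)"
    using lin by metis
  define c where "c = (\<Sum>j<k. a ^ j * u j)"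
  have const: "(\<Sum>j<k. a ^ j * tent (?b ^ j * x)) = c"
    if "of_int N \<le> 2 * ?b ^ m * x" "2 * ?b ^ m * x \<le> of_int N + 1" for x
  proof -
    have "(\<Sum>j<k. a ^ j * tent (?b ^ j * x)) = (\<Sum>j<k. a ^ j * (u j + \<eta> j * (?b ^ j * x)))"
      using u that m by (intro sum.cong) auto
    also have "\<dots> = c + (\<Sum>j<k. \<eta> j * (a * ?b) ^ j) * x"
      by (simp add: c_def sum_distrib_left sum.distrib algebra_simps power_mult_distrib)
    finally show ?thesis
      using root' by simp
  qed
  \<comment> \<open>In units of 1 / (2 b^k) the chosen interval is [bN, bN + b], so its half-periods
    have the numbers \<open>b * N + i\<close> with 0 \<le> i < b.\<close>
  define h where "h i t = unfold_half (b * N + i) t / ?b ^ k" for i t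
  have pos: "?b ^ k > 0"
    using \<open>b \<ge> 2\<close> by simp
  show thesis
  proof
    fix i :: int and t :: real assume i: "i \<in> {0..<b}" and t: "t \<in> {0..1/2}"
    have hb: "?b ^ k * h i t = unfold_half (b * N + i) t"
      using \<open>b \<ge> 2\<close> by (simp add: h_def)
    have "b * N \<le> b * N + i" "b * N + i + 1 \<le> b * (N + 1)"
      using i by (auto simp: algebra_simps)
    then have "?b * of_int N \<le> of_int (b * N + i)" "of_int (b * N + i + 1) \<le> ?b * (of_int N + 1)"
      unfolding of_int_mult[symmetric] of_int_1[symmetric, where 'a=real] of_int_add[symmetric] of_int_le_iff
      by simp_all
    then have "?b * of_int N \<le> 2 * (?b ^ k * h i t)" "2 * (?b ^ k * h i t) \<le> ?b * (of_int N + 1)"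
      using unfold_half_bounds[of 0 t "b * N + i"] t unfolding hb by auto
    then have "?b * of_int N \<le> ?b * (2 * ?b ^ m * h i t)"
      "?b * (2 * ?b ^ m * h i t) \<le> ?b * (of_int N + 1)"
      by (simp_all add: m mult_ac)
    then have "of_int N \<le> 2 * ?b ^ m * h i t" "2 * ?b ^ m * h i t \<le> of_int N + 1"
      using \<open>b \<ge> 2\<close> by (simp_all add: mult_le_cancel_left_pos)
    from const[OF this] show "?f (h i t) = c + a ^ k * ?f t"
      using takagi_split[of a ?b "h i t" k] assms(1,2) by (simp add: hb takagi_unfold_half)
  next
    fix i :: int and t t' :: real
    show "\<bar>h i t - h i t'\<bar> = \<bar>t - t'\<bar> / ?b ^ k"
      using unfold_half_diff[of "b * N + i" t t'] pos
      by (simp add: h_def diff_divide_distrib[symmetric])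
  next
    fix i :: int and t \<delta> :: real assume i: "i \<in> {0..<b}" and \<delta>: "0 \<le> \<delta>" "t \<in> {\<delta>..1/2 - \<delta>}"
    have "b * (N + 1) \<le> b * b ^ m"
      using N \<open>b \<ge> 2\<close> by (intro mult_left_mono) auto
    with i have "b * N + i + 1 \<le> b ^ k"
      by (simp add: m algebra_simps)
    then have "of_int (b * N + i + 1) \<le> ?b ^ k"
      unfolding of_int_power[symmetric] of_int_le_iff .
    moreover have "0 \<le> b * N + i"
      using N i by auto
    then have "0 \<le> (of_int (b * N + i) :: real)"
      unfolding of_int_0_le_iff .
    moreover have "of_int (b * N + i) / 2 + \<delta> \<le> unfold_half (b * N + i) t"
      "unfold_half (b * N + i) t \<le> of_int (b * N + i + 1) / 2 - \<delta>"
      using unfold_half_bounds[of \<delta> t "b * N + i"] \<delta>(2) unfolding atLeastAtMost_iff by blast+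
    ultimately have "\<delta> \<le> unfold_half (b * N + i) t" "unfold_half (b * N + i) t \<le> ?b ^ k / 2 - \<delta>"
      by argo+
    then have "\<delta> / ?b ^ k \<le> h i t" "h i t \<le> (?b ^ k / 2 - \<delta>) / ?b ^ k"
      unfolding h_def using pos by (simp_all only: divide_right_mono less_imp_le)
    then show "h i t \<in> {\<delta> / ?b ^ k..1/2 - \<delta> / ?b ^ k}"
      using \<open>b \<ge> 2\<close> by (simp add: diff_divide_distrib)
  next
    fix i j :: int and t t' \<delta> :: real
    assume ij: "i \<noteq> j" and t: "t \<in> {\<delta>..1/2 - \<delta>}" "t' \<in> {\<delta>..1/2 - \<delta>}"
    then have "b * N + i < b * N + j \<or> b * N + j < b * N + i"
      by linarith
    then have "2 * \<delta> \<le> \<bar>unfold_half (b * N + i) t - unfold_half (b * N + j) t'\<bar>"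
      using unfold_half_separated[OF _ t] unfold_half_separated[OF _ t(2,1)] by fastforce
    then show "2 * \<delta> / ?b ^ k \<le> \<bar>h i t - h j t'\<bar>"
      using pos by (simp add: h_def diff_divide_distrib[symmetric] divide_right_mono)
  qed
qed

section \<open>Iterating the copies\<close>

text \<open>\<open>A\<close> holds the midpoints of non-overlapping intervals of length \<open>\<rho>/2\<close>, all inside one interval
  of length \<open>D\<close>; over each of them \<open>f\<close> takes every value in \<open>[c, c + \<mu>/2]\<close>.\<close>

definition aligned_pieces ::
    "(real \<Rightarrow> real) \<Rightarrow> real \<Rightarrow> real \<Rightarrow> real \<Rightarrow> real \<Rightarrow> real set \<Rightarrow> bool" where
  "aligned_pieces f \<rho> \<mu> D c A \<longleftrightarrow> finite A \<and>
    (\<forall>x\<in>A. x \<in> {\<rho>/4..1/2 - \<rho>/4} \<and>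
      (\<forall>v\<in>{0..1/2}. \<exists>t. \<bar>t - x\<bar> \<le> \<rho>/4 \<and> f t = c + \<mu> * v)) \<and>
    (\<forall>x\<in>A. \<forall>y\<in>A. \<bar>x - y\<bar> \<le> D - \<rho>/2 \<and> (x \<noteq> y \<longrightarrow> \<rho>/2 \<le> \<bar>x - y\<bar>))"

lemma aligned_piecesD:
  assumes "aligned_pieces f \<rho> \<mu> D c A"
  shows "finite A"
    and "x \<in> A \<Longrightarrow> x \<in> {\<rho>/4..1/2 - \<rho>/4}"
    and "x \<in> A \<Longrightarrow> v \<in> {0..1/2} \<Longrightarrow> \<exists>t. \<bar>t - x\<bar> \<le> \<rho>/4 \<and> f t = c + \<mu> * v"
    and "x \<in> A \<Longrightarrow> y \<in> A \<Longrightarrow> \<bar>x - y\<bar> \<le> D - \<rho>/2"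
    and "x \<in> A \<Longrightarrow> y \<in> A \<Longrightarrow> x \<noteq> y \<Longrightarrow> \<rho>/2 \<le> \<bar>x - y\<bar>"
  using assms unfolding aligned_pieces_def by blast+

text \<open>Starting from the single piece [0, 1/2], \<open>q\<close> steps with all
  \<open>b\<close> branches produce b^q pieces; then \<open>p\<close> steps with the branch
  \<open>h 0\<close> alone shrink the whole configuration. Each step scales widths by b^(-k) and
  heights by a^k, and keeps the offset common to all pieces.\<close>

lemma takagi_aligned_pieces:
  fixes b :: int and \<epsilon> :: "nat \<Rightarrow> real"
  assumes "0 \<le> a" "a < 1" "b \<ge> 2" "k \<ge> 1"
    and \<epsilon>: "\<And>n. n < k \<Longrightarrow> \<epsilon> n \<in> {-1, 1}"
    and root: "(\<Sum>n<k. \<epsilon> n * (a * of_int b) ^ n) = 0"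
  shows "\<exists>c A. aligned_pieces (takagi a (of_int b)) ((1 / of_int b ^ k) ^ (p + q)) ((a ^ k) ^ (p + q))
    ((1 / of_int b ^ k) ^ p / 2) c A \<and> card A = nat b ^ q"
proof -
  let ?f = "takagi a (of_int b)"
  define s where "s = 1 / (of_int b :: real) ^ k"
  have s: "s > 0"
    using \<open>b \<ge> 2\<close> by (simp add: s_def)
  obtain h c0 where aff: "\<And>i t. i \<in> {0..<b} \<Longrightarrow> t \<in> {0..1/2} \<Longrightarrow> ?f (h i t) = c0 + a ^ k * ?f t"
    and scale: "\<And>i t t'. \<bar>h i t - h i t'\<bar> = s * \<bar>t - t'\<bar>"
    and into: "\<And>i t \<delta>. i \<in> {0..<b} \<Longrightarrow> 0 \<le> \<delta> \<Longrightarrow> t \<in> {\<delta>..1/2 - \<delta>} \<Longrightarrow>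
      h i t \<in> {s * \<delta>..1/2 - s * \<delta>}"
    and sep: "\<And>i j t t' \<delta>. i \<noteq> j \<Longrightarrow> t \<in> {\<delta>..1/2 - \<delta>} \<Longrightarrow> t' \<in> {\<delta>..1/2 - \<delta>} \<Longrightarrow>
      2 * (s * \<delta>) \<le> \<bar>h i t - h j t'\<bar>"
    using takagi_self_affine_pieces[OF assms] by (simp add: s_def) blast
  \<comment> \<open>Transport of a point with a prescribed value through \<open>h i\<close>. The new
    offset \<open>c0 + a ^ k * c\<close> is the same for every branch.\<close>
  have vals: "\<exists>t'. \<bar>t' - h i x\<bar> \<le> s * \<rho> / 4 \<and> ?f t' = (c0 + a ^ k * c) + (a ^ k * \<mu>) * v"
    if "i \<in> {0..<b}" "x \<in> {\<rho>/4..1/2 - \<rho>/4}" "\<bar>t - x\<bar> \<le> \<rho>/4" "?f t = c + \<mu> * v"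
    for i x t \<rho> \<mu> c v
  proof (intro exI[of _ "h i t"] conjI)
    show "\<bar>h i t - h i x\<bar> \<le> s * \<rho> / 4"
      using mult_left_mono[OF that(3), of s] s by (simp add: scale)
    have "t \<in> {0..1/2}"
      using that(2,3) unfolding atLeastAtMost_iff by linarith
    then show "?f (h i t) = (c0 + a ^ k * c) + (a ^ k * \<mu>) * v"
      using aff[of i t] that by (simp add: algebra_simps)
  qed
  have base: "aligned_pieces ?f 1 1 (1/2) 0 {1/4}"
    unfolding aligned_pieces_def
  proof (intro conjI ballI)
    fix x v :: real assume "x \<in> {1/4}" and v: "v \<in> {0..1/2}"
    obtain t where "t \<in> {0..1/2}" "?f t = v"
      using takagi_onto_half[OF assms(1,2) v] by blast
    moreover have "x = 1/4"
      using \<open>x \<in> {1/4}\<close> by simp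
    ultimately have "\<bar>t - x\<bar> \<le> 1/4" "?f t = 0 + 1 * v"
      unfolding atLeastAtMost_iff by linarith+
    then show "\<exists>t. \<bar>t - x\<bar> \<le> 1/4 \<and> ?f t = 0 + 1 * v"
      by blast
  qed auto
  have wide: "\<exists>c A. aligned_pieces ?f (s ^ q) ((a ^ k) ^ q) (1/2) c A \<and> card A = nat b ^ q"
  proof (induction q)
    case 0
    show ?case
      using base by (intro exI[of _ 0] exI[of _ "{1/4}"]) simp
  next
    case (Suc q)
    then obtain c A where A: "aligned_pieces ?f (s ^ q) ((a ^ k) ^ q) (1/2) c A" "card A = nat b ^ q"
      by blast
    define B where "B = (\<lambda>(i, x). h i x) ` ({0..<b} \<times> A)"
    have A1: "x \<in> {s ^ q / 4..1/2 - s ^ q / 4}" if "x \<in> A" for x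
      using aligned_piecesD(2)[OF A(1) that] .
    \<comment> \<open>Within one branch the old separation is scaled by \<open>s\<close>; between
      branches \<open>sep\<close> applies with margin s^q / 4. Positive separation also gives the
      injectivity behind the cardinality of \<open>B\<close>.\<close>
    have sepB: "s ^ Suc q / 2 \<le> \<bar>h i x - h j y\<bar>"
      if "i \<in> {0..<b}" "j \<in> {0..<b}" "x \<in> A" "y \<in> A" "(i, x) \<noteq> (j, y)" for i j x y
    proof (cases "i = j")
      case True
      with that have "s ^ q / 2 \<le> \<bar>x - y\<bar>"
        using aligned_piecesD(5)[OF A(1)] by blast
      from mult_left_mono[OF this, of s] s True show ?thesis
        by (simp add: scale)
    next
      case False
      from sep[OF False A1[OF that(3)] A1[OF that(4)]] show ?thesis
        by simp
    qed
    have "inj_on (\<lambda>(i, x). h i x) ({0..<b} \<times> A)"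
    proof (rule inj_onI, clarify)
      fix i x j y assume *: "i \<in> {0..<b}" "j \<in> {0..<b}" "x \<in> A" "y \<in> A" "h i x = h j y"
      show "i = j \<and> x = y"
      proof (rule ccontr)
        assume "\<not> ?thesis"
        then have "s ^ Suc q / 2 \<le> 0"
          using sepB[OF *(1-4)] *(5) by simp
        with zero_less_power[OF s, of "Suc q"] show False
          by linarith
      qed
    qed
    then have "card B = nat b ^ Suc q"
      using A(2) by (simp add: B_def card_image card_cartesian_product)
    moreover have "aligned_pieces ?f (s ^ Suc q) ((a ^ k) ^ Suc q) (1/2) (c0 + a ^ k * c) B"
      unfolding aligned_pieces_def
    proof (intro conjI ballI)
      show "finite B"
        using A(1) by (simp add: B_def aligned_pieces_def)
      show box: "x \<in> {s ^ Suc q / 4..1/2 - s ^ Suc q / 4}" if "x \<in> B" for x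
        using that into[of _ "s ^ q / 4"] A1 s by (fastforce simp: B_def)
      show "\<exists>t. \<bar>t - x\<bar> \<le> s ^ Suc q / 4 \<and> ?f t = c0 + a ^ k * c + (a ^ k) ^ Suc q * v"
        if x: "x \<in> B" and v: "v \<in> {0..1/2}" for x v
      proof -
        obtain i y where iy: "i \<in> {0..<b}" "y \<in> A" "x = h i y"
          using x by (auto simp: B_def)
        obtain t where "\<bar>t - y\<bar> \<le> s ^ q / 4" "?f t = c + (a ^ k) ^ q * v"
          using aligned_piecesD(3)[OF A(1) iy(2) v] by blast
        from vals[OF iy(1) A1[OF iy(2)] this] show ?thesis
          by (simp add: iy(3))
      qed
      show "\<bar>x - y\<bar> \<le> 1/2 - s ^ Suc q / 2" if "x \<in> B" "y \<in> B" for x y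
        using box[OF that(1)] box[OF that(2)] by (auto simp: abs_le_iff)
      show "x \<noteq> y \<longrightarrow> s ^ Suc q / 2 \<le> \<bar>x - y\<bar>" if "x \<in> B" "y \<in> B" for x y
        using that sepB by (fastforce simp: B_def)
    qed
    ultimately show ?case
      by blast
  qed
  have "\<exists>c A. aligned_pieces ?f (s ^ (p + q)) ((a ^ k) ^ (p + q)) (s ^ p / 2) c A \<and> card A = nat b ^ q"
  proof (induction p)
    case 0
    show ?case
      using wide by simp
  next
    case (Suc p)
    then obtain c A where A: "aligned_pieces ?f (s ^ (p + q)) ((a ^ k) ^ (p + q)) (s ^ p / 2) c A"
      "card A = nat b ^ q"
      by blast
    have zero: "0 \<in> {0..<b}"
      using \<open>b \<ge> 2\<close> by simp
    have A1: "x \<in> {s ^ (p + q) / 4..1/2 - s ^ (p + q) / 4}" if "x \<in> A" for x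
      using aligned_piecesD(2)[OF A(1) that] .
    have "inj_on (h 0) A"
    proof (rule inj_onI)
      fix x y assume "h 0 x = h 0 y"
      then show "x = y"
        using scale[of 0 x y] s by simp
    qed
    then have "card (h 0 ` A) = nat b ^ q"
      using A(2) by (simp add: card_image)
    moreover have "aligned_pieces ?f (s ^ (Suc p + q)) ((a ^ k) ^ (Suc p + q)) (s ^ Suc p / 2)
        (c0 + a ^ k * c) (h 0 ` A)"
      unfolding aligned_pieces_def
    proof (intro conjI ballI)
      show "finite (h 0 ` A)"
        using A(1) by (simp add: aligned_pieces_def)
      show "x \<in> {s ^ (Suc p + q) / 4..1/2 - s ^ (Suc p + q) / 4}" if "x \<in> h 0 ` A" for x
        using that into[OF zero, of "s ^ (p + q) / 4"] A1 s by fastforce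
      show "\<exists>t. \<bar>t - x\<bar> \<le> s ^ (Suc p + q) / 4 \<and> ?f t = c0 + a ^ k * c + (a ^ k) ^ (Suc p + q) * v"
        if x: "x \<in> h 0 ` A" and v: "v \<in> {0..1/2}" for x v
      proof -
        obtain y where y: "y \<in> A" "x = h 0 y"
          using x by auto
        obtain t where "\<bar>t - y\<bar> \<le> s ^ (p + q) / 4" "?f t = c + (a ^ k) ^ (p + q) * v"
          using aligned_piecesD(3)[OF A(1) y(1) v] by blast
        from vals[OF zero A1[OF y(1)] this] show ?thesis
          by (simp add: y(2))
      qed
      fix x y assume "x \<in> h 0 ` A" "y \<in> h 0 ` A"
      then obtain x' y' where xy: "x' \<in> A" "y' \<in> A" "x = h 0 x'" "y = h 0 y'"
        by blast
      then have "\<bar>x' - y'\<bar> \<le> s ^ p / 2 - s ^ (p + q) / 2"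
        and ne: "x' \<noteq> y' \<Longrightarrow> s ^ (p + q) / 2 \<le> \<bar>x' - y'\<bar>"
        using aligned_piecesD(4,5)[OF A(1) xy(1,2)] by blast+
      from mult_left_mono[OF this(1), of s] s show "\<bar>x - y\<bar> \<le> s ^ Suc p / 2 - s ^ (Suc p + q) / 2"
        by (simp add: xy scale algebra_simps)
      show "x \<noteq> y \<longrightarrow> s ^ (Suc p + q) / 2 \<le> \<bar>x - y\<bar>"
      proof
        assume "x \<noteq> y"
        with xy have "x' \<noteq> y'" by auto
        from mult_left_mono[OF ne[OF this], of s] s show "s ^ (Suc p + q) / 2 \<le> \<bar>x - y\<bar>"
          by (simp add: xy scale)
      qed
    qed
    ultimately show ?case
      by blast
  qed
  then show ?thesis
    by (simp add: s_def)
qed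

section \<open>Lower bound for covering numbers\<close>

lemma covering_number_cover:
  fixes F :: "'a::euclidean_space set"
  assumes "bounded F" "r > 0"
  obtains S where "finite S" "card S = covering_number r F" "F \<subseteq> (\<Union>c\<in>S. cball c r)"
proof -
  obtain S where "finite S" "F \<subseteq> (\<Union>c\<in>S. cball c r)"
    using finite_cover_exists[OF assms] by blast
  then have "\<exists>m S. finite S \<and> card S = m \<and> F \<subseteq> (\<Union>c\<in>S. cball c r)"
    by blast
  from LeastI_ex[OF this] show thesis
    using that by (auto simp: covering_number_def)
qed

text \<open>Over each piece take graph points at heights c + 3rj for j \<le> m;
  \<open>R \<le> \<mu>\<close> makes these heights available. A ball of radius \<open>r\<close>
  contains points of one height only, as 2r < 3r, and of at most 6 pieces. With R / r \<le> 6 (m +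
  1) this gives the factor 36.\<close>

lemma covering_number_aligned_pieces:
  assumes A: "aligned_pieces f r \<mu> (R / 2) c A" "A \<noteq> {}" and r: "0 < r" and R: "0 < R" "R \<le> \<mu>"
  shows "\<exists>z\<in>graph_on_unit f.
    real (card A) * (R / r) \<le> 36 * real (covering_number r (cball z R \<inter> graph_on_unit f))"
proof -
  \<comment> \<open>Largest number with 3rm \<le> R/2. Horizontal and vertical distances are then
    both at most R/2, so all points lie in one ball of radius \<open>R\<close>.\<close>
  define m where "m = nat \<lfloor>R / (6 * r)\<rfloor>"
  have fin: "finite A"
    using aligned_piecesD(1)[OF A(1)] .
  have m: "3 * r * real j \<le> R / 2" if "j \<le> m" for j
  proof -
    have "real j \<le> real m"
      using that by simp
    also have "real m \<le> R / (6 * r)"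
      using r R by (simp add: m_def)
    finally show ?thesis
      using r by (simp add: field_simps)
  qed
  have "\<exists>t. \<bar>t - x\<bar> \<le> r/4 \<and> f t = c + 3 * r * real j" if xj: "x \<in> A" "j \<le> m" for x j
  proof -
    have "3 * r * real j / \<mu> \<in> {0..1/2}"
      using m[OF xj(2)] r R by (auto simp: field_simps)
    then obtain t where "\<bar>t - x\<bar> \<le> r/4" "f t = c + \<mu> * (3 * r * real j / \<mu>)"
      using aligned_piecesD(3)[OF A(1) xj(1)] by blast
    then show ?thesis
      using R by auto
  qed
  then obtain t where t: "\<And>x j. x \<in> A \<Longrightarrow> j \<le> m \<Longrightarrow> \<bar>t x j - x\<bar> \<le> r/4"
    and ft: "\<And>x j. x \<in> A \<Longrightarrow> j \<le> m \<Longrightarrow> f (t x j) = c + 3 * r * real j"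
    by metis
  define P where "P x j = (t x j, c + 3 * r * real j)" for x j
  have P: "P x j \<in> graph_on_unit f" if "x \<in> A" "j \<le> m" for x j
  proof -
    have "x \<in> {r/4..1/2 - r/4}"
      using aligned_piecesD(2)[OF A(1)] that(1) .
    then have "t x j \<in> {0..1}"
      using t[OF that] r unfolding atLeastAtMost_iff by linarith
    then show ?thesis
      using ft[OF that] by (simp add: P_def graph_on_unit_def)
  qed
  obtain x0 where x0: "x0 \<in> A"
    using A(2) by blast
  define F where "F = cball (P x0 0) R \<inter> graph_on_unit f"
  have PF: "P x j \<in> F" if "x \<in> A" "j \<le> m" for x j
  proof -
    have "\<bar>x - x0\<bar> \<le> R/2 - r/2"
      using aligned_piecesD(4)[OF A(1) that(1) x0] .
    then have "\<bar>t x0 0 - t x j\<bar> \<le> R/2"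
      using t[OF that] t[OF x0, of 0] by linarith
    moreover have "dist (P x0 0) (P x j) \<le> \<bar>t x0 0 - t x j\<bar> + \<bar>3 * r * real j\<bar>"
      using sqrt_sum_squares_le_sum_abs[of "t x0 0 - t x j" "3 * r * real j"]
      by (simp add: P_def dist_Pair_Pair dist_real_def)
    ultimately have "dist (P x0 0) (P x j) \<le> R"
      using m[OF that(2)] r by simp
    then show ?thesis
      using P[OF that] by (simp add: F_def)
  qed
  obtain S where S: "finite S" "card S = covering_number r F" "F \<subseteq> (\<Union>c\<in>S. cball c r)"
    using covering_number_cover[of F r] r by (auto simp: F_def bounded_Int)
  define G where "G z = {(x, j). x \<in> A \<and> j \<le> m \<and> P x j \<in> cball z r}" for z
  have "card (G z) \<le> 6" for z
  proof -
    \<comment> \<open>A piece with a point in the ball has its midpoint within r + r/4 = 5r/4 of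
      \<open>fst z\<close>. So 2x/r lies in [w, w + 5], where its floor takes at most 6 values;
      midpoints at least r/2 apart have different floors.\<close>
    define w where "w = 2 * fst z / r - 5/2"
    have near: "\<bar>t x j - fst z\<bar> \<le> r" "\<bar>c + 3 * r * real j - snd z\<bar> \<le> r" if "(x, j) \<in> G z" for x j
      using that dist_fst_le[of "P x j" z] dist_snd_le[of "P x j" z]
      by (auto simp: G_def P_def dist_commute dist_real_def)
    have inj: "inj_on (\<lambda>(x, j). \<lfloor>2 * x / r\<rfloor>) (G z)"
    proof (rule inj_onI, clarify)
      fix x j y i assume G: "(x, j) \<in> G z" "(y, i) \<in> G z" and eq: "\<lfloor>2 * x / r\<rfloor> = \<lfloor>2 * y / r\<rfloor>"
      have "\<bar>2 * x / r - 2 * y / r\<bar> < 1"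
        using floor_correct[of "2 * x / r"] floor_correct[of "2 * y / r"] eq by linarith
      then have "\<bar>2 * x - 2 * y\<bar> < r"
        using r by (simp add: diff_divide_distrib[symmetric])
      then have "\<bar>x - y\<bar> < r / 2"
        by linarith
      moreover have "x \<in> A" "y \<in> A"
        using G by (auto simp: G_def)
      ultimately have "x = y"
        using aligned_piecesD(5)[OF A(1), of x y] by linarith
      have "\<bar>3 * r * real j - 3 * r * real i\<bar> \<le> 2 * r"
        using near(2)[OF G(1)] near(2)[OF G(2)] by linarith
      also have "\<bar>3 * r * real j - 3 * r * real i\<bar> = r * (3 * \<bar>real j - real i\<bar>)"
        using r by (simp add: abs_mult flip: right_diff_distrib)
      finally have "real_of_int (3 * \<bar>int j - int i\<bar>) \<le> real_of_int 2"
        using r by (simp add: mult.commute[of 2 r])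
      then have "3 * \<bar>int j - int i\<bar> \<le> 2"
        unfolding of_int_le_iff .
      then have "j = i"
        by presburger
      with \<open>x = y\<close> show "x = y \<and> j = i" by simp
    qed
    have "(\<lambda>(x, j). \<lfloor>2 * x / r\<rfloor>) ` G z \<subseteq> {\<lfloor>w\<rfloor>..\<lfloor>w\<rfloor> + 5}"
    proof clarify
      fix x j assume G: "(x, j) \<in> G z"
      then have "x \<in> A" "j \<le> m" by (auto simp: G_def)
      have "\<bar>x - fst z\<bar> \<le> 5 * r / 4"
        using near(1)[OF G] t[OF \<open>x \<in> A\<close> \<open>j \<le> m\<close>] by linarith
      then have "2 * fst z - 5/2 * r \<le> 2 * x" "2 * x \<le> 2 * fst z + 5/2 * r"
        by linarith+
      then have "(2 * fst z - 5/2 * r) / r \<le> 2 * x / r" "2 * x / r \<le> (2 * fst z + 5/2 * r) / r"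
        using r by (simp_all only: divide_right_mono less_imp_le)
      then have "w \<le> 2 * x / r" "2 * x / r \<le> w + 5"
        using r by (simp_all add: w_def diff_divide_distrib add_divide_distrib)
      then have "\<lfloor>w\<rfloor> \<le> \<lfloor>2 * x / r\<rfloor>" "\<lfloor>2 * x / r\<rfloor> \<le> \<lfloor>w + 5\<rfloor>"
        using floor_mono by blast+
      then show "\<lfloor>2 * x / r\<rfloor> \<in> {\<lfloor>w\<rfloor>..\<lfloor>w\<rfloor> + 5}"
        by simp
    qed
    from card_mono[OF _ this] card_image[OF inj] show ?thesis
      by simp
  qed
  have "A \<times> {..m} \<subseteq> (\<Union>z\<in>S. G z)"
    using PF S(3) by (fastforce simp: G_def)
  moreover have "finite (G z)" for z
    by (rule finite_subset[of _ "A \<times> {..m}"]) (use fin in \<open>auto simp: G_def\<close>)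
  ultimately have "card (A \<times> {..m}) \<le> card (\<Union>z\<in>S. G z)"
    using S(1) by (intro card_mono) auto
  also have "\<dots> \<le> (\<Sum>z\<in>S. card (G z))"
    by (rule card_UN_le[OF S(1)])
  also have "\<dots> \<le> card S * 6"
    using sum_bounded_above[of S "\<lambda>z. card (G z)" 6] \<open>\<And>z. card (G z) \<le> 6\<close> by simp
  finally have "card A * Suc m \<le> card S * 6"
    by (simp add: card_cartesian_product)
  then have count: "real (card A) * real (Suc m) \<le> 6 * real (card S)"
    unfolding of_nat_mult[symmetric] by linarith
  have "R / (6 * r) \<le> real (Suc m)"
    using r R unfolding m_def by linarith
  then have "R / r \<le> 6 * real (Suc m)"
    using r by (simp add: field_simps)
  then have "real (card A) * (R / r) \<le> real (card A) * (6 * real (Suc m))"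
    by (intro mult_left_mono) auto
  also have "\<dots> \<le> 36 * real (card S)"
    using mult_left_mono[OF count, of 6] by (simp add: mult_ac)
  finally show ?thesis
    using P[OF x0, of 0] S(2) by (auto simp: F_def)
qed

section \<open>The dimension bound\<close>

theorem theorem1p1:
  fixes a :: real and b :: int and k :: nat and \<epsilon> :: "nat \<Rightarrow> real"
  assumes "a < 1"
    and "a * real_of_int b > 1"
    and "b > 2"
    and "k \<ge> 1"
    and "\<And>n. n < k \<Longrightarrow> \<epsilon> n \<in> {-1, 1}"
    and "(\<Sum>n<k. \<epsilon> n * (a * real_of_int b) ^ n) = 0"
  shows "assouad_dim (graph_on_unit (takagi a (real_of_int b))) \<ge> ereal (1 + 1 / real k)"
  unfolding assouad_dim_def
proof (rule INF_greatest)
  let ?b = "real_of_int b"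
  let ?F = "graph_on_unit (takagi a ?b)"
  fix d assume "d \<in> {s. s \<ge> 0 \<and> (\<exists>C>0. \<forall>R>0. \<forall>r\<in>{0<..<R}. \<forall>x\<in>?F.
        real (covering_number r (cball x R \<inter> ?F)) \<le> C * (R / r) powr s)}"
  then obtain C where cov: "\<And>R r x. R > 0 \<Longrightarrow> r \<in> {0<..<R} \<Longrightarrow> x \<in> ?F \<Longrightarrow>
      real (covering_number r (cball x R \<inter> ?F)) \<le> C * (R / r) powr d"
    by blast
  \<comment> \<open>The hypotheses force 0 < a < 1, so the series converges.\<close>
  have "0 < a * ?b"
    using assms(2) by linarith
  then have "a > 0"
    using \<open>b > 2\<close> by (simp add: zero_less_mult_iff)
  define s where "s = 1 / ?b ^ k"
  have s: "0 < s" "s < 1"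
    using \<open>b > 2\<close> \<open>k \<ge> 1\<close> by (auto simp: s_def)
  \<comment> \<open>Covering bound at the scales R = s^p and r = s^(p + q), where R / r = b^(kq) and
    there are b^q pieces. As \<open>C\<close> is independent of the scales, \<open>p\<close> may
    depend on \<open>q\<close>; the condition \<open>q \<ge> 1\<close> gives r < R.\<close>
  have bound: "(?b powr (1 + real k - real k * d)) ^ q \<le> 36 * C" if "q \<ge> 1" for q
  proof -
    have "1 < (a * ?b) ^ k"
      using assms(2,4) by (simp add: one_less_power)
    \<comment> \<open>Since (ab)^k > 1, a large \<open>p\<close> compensates the factor a^(kq) and
      yields R \<le> \<mu> for the vertical scale \<mu> = a^(k(p + q)).\<close>
    then obtain p where "1 / (a ^ k) ^ q < ((a * ?b) ^ k) ^ p"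
      using real_arch_pow by blast
    then have p: "s ^ p \<le> (a ^ k) ^ (p + q)"
      using \<open>a > 0\<close> \<open>b > 2\<close> by (simp add: s_def field_simps power_mult_distrib power_add)
    obtain c A where A: "aligned_pieces (takagi a ?b) (s ^ (p + q)) ((a ^ k) ^ (p + q)) (s ^ p / 2) c A"
      "card A = nat b ^ q"
      using takagi_aligned_pieces[of a b k \<epsilon> p q] assms \<open>a > 0\<close> unfolding s_def by auto
    have "A \<noteq> {}"
      using A(2) \<open>b > 2\<close> by auto
    then obtain z where z: "z \<in> ?F" "real (card A) * (s ^ p / s ^ (p + q))
        \<le> 36 * real (covering_number (s ^ (p + q)) (cball z (s ^ p) \<inter> ?F))"
      using covering_number_aligned_pieces[OF A(1)] s p by auto
    have "s ^ (p + q) < s ^ p"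
      using s that by (intro power_strict_decreasing) auto
    then have "real (covering_number (s ^ (p + q)) (cball z (s ^ p) \<inter> ?F))
        \<le> C * (s ^ p / s ^ (p + q)) powr d"
      using s z(1) by (intro cov) auto
    with z(2) have main: "real (card A) * (s ^ p / s ^ (p + q)) \<le> 36 * C * (s ^ p / s ^ (p + q)) powr d"
      by linarith
    have ratio: "s ^ p / s ^ (p + q) = ?b powr (real k * real q)"
      using s \<open>b > 2\<close> by (simp add: power_add s_def power_one_over powr_realpow power_mult[symmetric]
          flip: of_nat_mult)
    have cardA: "real (card A) = ?b powr real q"
      using A(2) \<open>b > 2\<close> by (simp add: powr_realpow)
    have "?b powr real q * ?b powr (real k * real q) \<le> 36 * C * ?b powr (real k * real q * d)"
      using main unfolding ratio cardA powr_powr .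
    then have "?b powr (real q + real k * real q - real k * real q * d) \<le> 36 * C"
      using \<open>b > 2\<close> by (simp add: powr_add powr_diff field_simps)
    also have "real q + real k * real q - real k * real q * d = (1 + real k - real k * d) * real q"
      by (simp add: algebra_simps)
    also have "?b powr \<dots> = (?b powr (1 + real k - real k * d)) ^ q"
      using \<open>b > 2\<close> by (simp add: powr_powr[symmetric] powr_realpow)
    finally show ?thesis .
  qed
  have "1 + 1 / real k \<le> d"
  proof (rule ccontr)
    assume "\<not> ?thesis"
    then have "0 < 1 + real k - real k * d"
      using \<open>k \<ge> 1\<close> by (simp add: field_simps)
    \<comment> \<open>If d < 1 + 1/k, the base of the power in \<open>bound\<close> exceeds 1, so
      its powers cannot stay below 36C.\<close>
    then have gt: "1 < ?b powr (1 + real k - real k * d)"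
      using \<open>b > 2\<close> by simp
    then obtain q where q: "36 * C < (?b powr (1 + real k - real k * d)) ^ q"
      using real_arch_pow by blast
    \<comment> \<open>\<open>bound\<close> requires a positive exponent, hence the passage from
      \<open>q\<close> to \<open>Suc q\<close>.\<close>
    also have "\<dots> \<le> (?b powr (1 + real k - real k * d)) ^ Suc q"
      using gt by (intro power_increasing) auto
    finally show False
      using bound[of "Suc q"] by simp
  qed
  then show "ereal (1 + 1 / real k) \<le> ereal d"
    by simp
qed

end
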